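(* If $a\neq 0$ is a real number, then there exists a unique real number $b\neq 0$ such that $ab=1$, where $ab$ is the geometric product. (This $b$ is called the inverse of $a$ and denoted $\frac{1}{a}$.)
   Context: Work in the Euclidean plane (with Euclid's/Hilbert's axioms of plane geometry) with perpendicular $x$- and $y$-axes meeting at the origin $(0,0)$ and a common unit length on both axes. A line is regarded as parallel to itself. Geometric product: for real numbers $a$ and $b$, lay $a$ along the $y$-axis and $b$ along the $x$-axis; $ab$ ("$a$ multiplied by $b$") is defined to be the $x$-intercept of the line through the point $(0,a)$ that is parallel to the segment joining $(b,0)$ and $(0,1)$. Every product in the claim is meant in this sense; no other notion of multiplication is presupposed. *)

theory Defs
  imports "HOL-Analysis.Analysis"
begin

text \<open>
  The Euclidean plane is the type \<^typ>\<open>real \<times> real\<close> with its standard (Euclidean) inner product.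
\<close>

type_synonym plane = "real \<times> real"

definition line_through :: "plane \<Rightarrow> plane \<Rightarrow> plane set" where
  "line_through P Q = affine hull {P, Q}"

definition is_line :: "plane set \<Rightarrow> bool" where
  "is_line L \<longleftrightarrow> (\<exists>P Q. P \<noteq> Q \<and> L = line_through P Q)"

text \<open>
  Parallelism in the sense of Euclid and Hilbert (coplanar lines that do not meet), with the
  convention that a line is parallel to itself.
\<close>

definition parallel :: "plane set \<Rightarrow> plane set \<Rightarrow> bool" where
  "parallel L M \<longleftrightarrow> is_line L \<and> is_line M \<and> (L = M \<or> L \<inter> M = {})"

definition x_axis :: "plane set" where
  "x_axis = line_through (0, 0) (1, 0)"

definition is_geom_prod :: "real \<Rightarrow> real \<Rightarrow> real \<Rightarrow> bool" where
  "is_geom_prod a b c \<longleftrightarrow>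
     (\<exists>L. (0, a) \<in> L \<and> parallel L (line_through (b, 0) (0, 1)) \<and> L \<inter> x_axis = {(c, 0)})"

definition geom_prod :: "real \<Rightarrow> real \<Rightarrow> real" (infixl \<open>\<odot>\<close> 70) where
  "a \<odot> b = (THE c. is_geom_prod a b c)"

lemma line_through_eq:
  assumes "P \<noteq> Q"
  shows "line_through P Q =
    {(x, y). (snd Q - snd P) * (x - fst P) = (fst Q - fst P) * (y - snd P)}"
proof (intro set_eqI iffI)
  fix Z assume "Z \<in> line_through P Q"
  then obtain u v where uv: "u + v = 1" "Z = u *\<^sub>R P + v *\<^sub>R Q"
    by (auto simp: line_through_def affine_hull_2)
  have u: "u = 1 - v" using uv by simp
  show "Z \<in> {(x, y). (snd Q - snd P) * (x - fst P) = (fst Q - fst P) * (y - snd P)}"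
    unfolding uv(2) u by (cases P; cases Q) (simp add: algebra_simps)
next
  fix Z assume "Z \<in> {(x, y). (snd Q - snd P) * (x - fst P) = (fst Q - fst P) * (y - snd P)}"
  then obtain x y where Z: "Z = (x, y)"
    and e: "(snd Q - snd P) * (x - fst P) = (fst Q - fst P) * (y - snd P)" by auto
  define v where "v = (if fst Q \<noteq> fst P then (x - fst P) / (fst Q - fst P)
                       else (y - snd P) / (snd Q - snd P))"
  have "x = fst P + v * (fst Q - fst P) \<and> y = snd P + v * (snd Q - snd P)"
  proof (cases "fst Q = fst P")
    case True
    then have "snd Q - snd P \<noteq> 0" using assms by (auto simp: prod_eq_iff)
    then show ?thesis using True e by (simp add: v_def)
  next
    case False
    then have "v * (fst Q - fst P) = x - fst P" "v * (snd Q - snd P) = y - snd P"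
      using e by (simp_all add: v_def field_simps)
    then show ?thesis by simp
  qed
  then have "Z = (1 - v) *\<^sub>R P + v *\<^sub>R Q"
    unfolding Z by (simp add: prod_eq_iff algebra_simps)
  then show "Z \<in> line_through P Q"
    unfolding line_through_def affine_hull_2
    by (intro CollectI exI[of _ "1 - v"] exI[of _ v]) simp
qed

lemma is_line_coords:
  assumes "is_line L"
  obtains p q r where "p \<noteq> 0 \<or> q \<noteq> 0" "L = {(x, y). p * x + q * y = (r::real)}"
proof -
  obtain P Q where PQ: "P \<noteq> Q" "L = line_through P Q" using assms by (auto simp: is_line_def)
  show ?thesis
    by (rule that[of "snd Q - snd P" "fst P - fst Q"
          "(snd Q - snd P) * fst P + (fst P - fst Q) * snd P"])
       (use PQ in \<open>auto simp: line_through_eq prod_eq_iff algebra_simps\<close>)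
qed

text \<open>The product is well defined for all \<open>a\<close> and \<open>b\<close>, including \<open>a = 0\<close> and \<open>b = 0\<close>.\<close>

lemma ex1_is_geom_prod: "\<exists>!c. is_geom_prod a b c"
proof -
  let ?M = "line_through (b, 0) (0, 1)"
  have M: "?M = {(x, y). x + b * y = b}" by (subst line_through_eq) (auto simp: algebra_simps)
  have X: "x_axis = {(x, y). y = 0}" unfolding x_axis_def by (subst line_through_eq) auto
  have lM: "is_line ?M" unfolding is_line_def by (intro exI[of _ "(b, 0)"] exI[of _ "(0, 1)"]) simp
  show ?thesis
  proof
    define L where "L = line_through (a * b, 0) ((a - 1) * b, 1)"
    have L: "L = {(x, y). x + b * y = a * b}"
      unfolding L_def by (subst line_through_eq) (auto simp: algebra_simps)
    have "is_line L" unfolding is_line_def L_def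
      by (intro exI[of _ "(a * b, 0)"] exI[of _ "((a - 1) * b, 1)"]) simp
    moreover have "L = ?M \<or> L \<inter> ?M = {}" unfolding L M by (cases "a * b = b") auto
    ultimately have "parallel L ?M" using lM by (simp add: parallel_def)
    moreover have "(0, a) \<in> L" "L \<inter> x_axis = {(a * b, 0)}" unfolding L X by auto
    ultimately show "is_geom_prod a b (a * b)" unfolding is_geom_prod_def by blast
  next
    fix c assume "is_geom_prod a b c"
    then obtain L where L: "(0, a) \<in> L" "is_line L" "L = ?M \<or> L \<inter> ?M = {}"
      "L \<inter> x_axis = {(c, 0)}" by (auto simp: is_geom_prod_def parallel_def)
    obtain p q r where pq: "p \<noteq> 0 \<or> q \<noteq> 0" and Leq: "L = {(x, y). p * x + q * y = r}"
      using L(2) by (rule is_line_coords)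
    have r: "q * a = r" using L(1) Leq by simp
    have "(c, 0) \<in> L" using L(4) by blast
    then have c: "p * c = r" using Leq by simp
    have q: "q = p * b"
    proof (rule ccontr)
      assume ne: "q \<noteq> p * b"
      define y where "y = (r - p * b) / (q - p * b)"
      have y: "y * (q - p * b) = r - p * b" using ne by (simp add: y_def)
      have "(b - b * y, y) \<in> L \<inter> ?M" using y unfolding Leq M by (auto simp: algebra_simps)
      then have "L = ?M" using L(3) by blast
      then have "(b, 0) \<in> L" "(0, 1) \<in> L" unfolding M by auto
      then show False using ne unfolding Leq by auto
    qed
    then have "p \<noteq> 0" using pq by auto
    moreover have "p * c = p * (a * b)" using r c q by (simp add: algebra_simps)
    ultimately show "c = a * b" by simp
  qed
qed

end

theory Submission
  imports Defs
begin

text \<open>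
  In coordinates, the line joining \<open>(b, 0)\<close> and \<open>(0, 1)\<close> is \<open>x + b * y = b\<close>, also when \<open>b = 0\<close>.
  Its parallel through \<open>(0, a)\<close> changes only the constant term, to \<open>a * b\<close>, and so cuts the
  \<open>x\<close>-axis at \<open>a * b\<close>. For positive \<open>a\<close> and \<open>b\<close> this says that the right triangles that the two
  lines form with the axes are similar with ratio \<open>a\<close>. Hence the geometric product is
  multiplication of the field of real numbers
  (\<open>geom_prod_eq_times\<close>), and the inverse of \<open>a\<close> is the field inverse.
\<close>

text \<open>
  By uniqueness of the geometric product it suffices to exhibit one admissible line. The two points
  that define it are its intersections with \<open>y = 0\<close> and \<open>y = 1\<close>, which are distinct for all
  \<open>a\<close> and \<open>b\<close>, whereas the intercepts on the two axes coincide when \<open>a = 0\<close>.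
\<close>

lemma geom_prod_eq_times: "a \<odot> b = a * b"
proof -
  define M where "M = line_through (b, 0) (0, 1)"
  define L where "L = line_through (a * b, 0) (a * b - b, 1)"
  have M: "M = {(x, y). x + b * y = b}"
    unfolding M_def by (subst line_through_eq) (auto simp: algebra_simps)
  have L: "L = {(x, y). x + b * y = a * b}"
    unfolding L_def by (subst line_through_eq) (auto simp: algebra_simps)
  have X: "x_axis = {(x, y). y = 0}"
    unfolding x_axis_def by (subst line_through_eq) auto
  have "is_line L" "is_line M"
    unfolding is_line_def L_def M_def by fastforce+
  \<comment> \<open>The lines coincide when the constant terms agree, that is, for \<open>a = 1\<close> or \<open>b = 0\<close>.\<close>
  moreover have "L = M \<or> L \<inter> M = {}"
    unfolding L M by (cases "a * b = b") auto
  ultimately have "parallel L M"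
    by (simp add: parallel_def)
  moreover have "(0, a) \<in> L" "L \<inter> x_axis = {(a * b, 0)}"
    unfolding L X by auto
  ultimately have "is_geom_prod a b (a * b)"
    unfolding is_geom_prod_def M_def by blast
  then show ?thesis
    unfolding geom_prod_def by (rule the1_equality[OF ex1_is_geom_prod])
qed

theorem theorem4:
  fixes a :: real
  assumes "a \<noteq> 0"
  shows "\<exists>!b::real. b \<noteq> 0 \<and> a \<odot> b = 1"
proof
  show "inverse a \<noteq> 0 \<and> a \<odot> inverse a = 1"
    using assms by (simp add: geom_prod_eq_times)
next
  fix b assume "b \<noteq> 0 \<and> a \<odot> b = 1"
  then have "a * b = 1"
    by (simp add: geom_prod_eq_times)
  then show "b = inverse a"
    by (simp add: inverse_unique)
qed

end
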